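(* Let $S$ be a set and let $M, I, J, K : S\to S$ be operators. For operators $P,Q$ on $S$ write $PQ$ for the operator that applies $P$ first and then $Q$, and write $1$ for the identity operator. Assume (0) $MM=1$; (1) $II=M$, $JJ=M$, $KK=M$; (2) $IJ=K$; (3) $M$ commutes with each of $I$, $J$, $K$. Then the quaternion relations hold, with $M$ playing the role of $-1$: $$II=JJ=KK=IJK=M,$$ $$IJ=K,\quad JK=I,\quad KI=J,$$ $$JI=KM,\quad KJ=IM,\quad IK=JM.$$
   Context: In the paper, $M$ is the Laws of Form mark acting by enclosure (satisfying the law that enclosing twice gives back the original expression), and $I,J,K$ are three additional "imaginary" marks acting by enclosure. The relations in the conclusion are the defining multiplication rules of the quaternion group $Q_8=\{\pm1,\pm i,\pm j,\pm k\}$, namely $i^2=j^2=k^2=ijk=-1$, $ij=k$, $jk=i$, $ki=j$, $ji=-k$, $kj=-i$, $ik=-j$. *)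

theory Defs
  imports "HOL-Library.FuncSet"
begin

text \<open>Operators on a set \<open>S\<close> are the elements of \<open>S \<rightarrow>\<^sub>E S\<close>. Such functions are
  \<open>undefined\<close> outside \<open>S\<close>, so that equality of operators is equality at all points of \<open>S\<close>.\<close>

text \<open>Juxtaposition is in diagrammatic order: \<open>P \<Zcomp>\<^bsub>S\<^esub> Q\<close> applies \<open>P\<close> first and then
  \<open>Q\<close>, the reverse of the argument order of \<^const>\<open>compose\<close>.\<close>

definition op_seq :: "('a \<Rightarrow> 'a) \<Rightarrow> 'a set \<Rightarrow> ('a \<Rightarrow> 'a) \<Rightarrow> 'a \<Rightarrow> 'a"
    ("(_ \<Zcomp>\<^bsub>_\<^esub> _)" [70, 0, 71] 70)
  where "P \<Zcomp>\<^bsub>S\<^esub> Q = compose S Q P"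

definition op_one :: "'a set \<Rightarrow> 'a \<Rightarrow> 'a"
  where "op_one S = (\<lambda>x\<in>S. x)"

end

theory Submission
  imports Defs
begin

text \<open>Associativity, \<open>IJ = K\<close> and \<open>II = JJ = M\<close> give \<open>IK = MJ\<close> and \<open>KJ = IM\<close>.
  Cancelling the invertible \<open>M\<close> in \<open>M(JK) = I(IJK) = IM\<close> and \<open>(KI)M = (KIJ)J = MJ\<close>
  gives \<open>JK = I\<close> and \<open>KI = J\<close>, and then \<open>JI = JJK = MK\<close>.\<close>

text \<open>At a point x of \<open>S\<close> both sides reduce to R (Q (P x)). On the right the
  composite of \<open>Q\<close> and \<open>R\<close> is evaluated at P x, and the hypothesis puts P
  x in \<open>S\<close>, where that composite is not \<open>undefined\<close>.\<close>

lemma op_seq_assoc: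
  assumes "P \<in> S \<rightarrow>\<^sub>E S"
  shows "P \<Zcomp>\<^bsub>S\<^esub> Q \<Zcomp>\<^bsub>S\<^esub> R = P \<Zcomp>\<^bsub>S\<^esub> (Q \<Zcomp>\<^bsub>S\<^esub> R)"
  using assms by (auto simp: op_seq_def compose_def restrict_def fun_eq_iff)

lemma op_seq_in_PiE:
  assumes "P \<in> S \<rightarrow>\<^sub>E S" and "Q \<in> S \<rightarrow>\<^sub>E S"
  shows "P \<Zcomp>\<^bsub>S\<^esub> Q \<in> S \<rightarrow>\<^sub>E S"
  using assms by (auto simp: op_seq_def compose_def)

text \<open>Outside \<open>S\<close> the left side is \<open>undefined\<close> by construction, and
  \<open>PiE_arb\<close> gives the same for \<open>P\<close>; this makes \<open>op_one\<close> a
  true unit for equality of functions.\<close>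

lemma op_one_seq:
  assumes "P \<in> S \<rightarrow>\<^sub>E S"
  shows "op_one S \<Zcomp>\<^bsub>S\<^esub> P = P"
  unfolding op_seq_def op_one_def compose_def
  by (rule ext) (use assms PiE_arb[OF assms] in \<open>auto simp: PiE_mem\<close>)

lemma op_seq_one:
  assumes "P \<in> S \<rightarrow>\<^sub>E S"
  shows "P \<Zcomp>\<^bsub>S\<^esub> op_one S = P"
  unfolding op_seq_def op_one_def compose_def
  by (rule ext) (use assms PiE_arb[OF assms] in \<open>auto simp: PiE_mem\<close>)

text \<open>\<open>M\<close> is its own inverse, so composing with a second \<open>M\<close> in
  front and reassociating removes it.\<close>

lemma op_seq_involution_left_cancel:
  assumes "M \<in> S \<rightarrow>\<^sub>E S" and "P \<in> S \<rightarrow>\<^sub>E S" and "Q \<in> S \<rightarrow>\<^sub>E S"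
    and "M \<Zcomp>\<^bsub>S\<^esub> M = op_one S" and "M \<Zcomp>\<^bsub>S\<^esub> P = M \<Zcomp>\<^bsub>S\<^esub> Q"
  shows "P = Q"
proof -
  have "M \<Zcomp>\<^bsub>S\<^esub> M \<Zcomp>\<^bsub>S\<^esub> P = M \<Zcomp>\<^bsub>S\<^esub> M \<Zcomp>\<^bsub>S\<^esub> Q"
    by (simp only: op_seq_assoc[OF assms(1)] assms(5))
  then show ?thesis
    by (simp only: assms(4) op_one_seq[OF assms(2)] op_one_seq[OF assms(3)])
qed

lemma op_seq_involution_right_cancel:
  assumes "M \<in> S \<rightarrow>\<^sub>E S" and "P \<in> S \<rightarrow>\<^sub>E S" and "Q \<in> S \<rightarrow>\<^sub>E S"
    and "M \<Zcomp>\<^bsub>S\<^esub> M = op_one S" and "P \<Zcomp>\<^bsub>S\<^esub> M = Q \<Zcomp>\<^bsub>S\<^esub> M"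
  shows "P = Q"
proof -
  have "P \<Zcomp>\<^bsub>S\<^esub> (M \<Zcomp>\<^bsub>S\<^esub> M) = Q \<Zcomp>\<^bsub>S\<^esub> (M \<Zcomp>\<^bsub>S\<^esub> M)"
    by (simp only: op_seq_assoc[OF assms(2), symmetric] op_seq_assoc[OF assms(3), symmetric] assms(5))
  then show ?thesis
    by (simp only: assms(4) op_seq_one[OF assms(2)] op_seq_one[OF assms(3)])
qed

theorem mainTheorem2:
  fixes S :: "'a set" and M I J K :: "'a \<Rightarrow> 'a"
  assumes "M \<in> S \<rightarrow>\<^sub>E S" and "I \<in> S \<rightarrow>\<^sub>E S" and "J \<in> S \<rightarrow>\<^sub>E S" and "K \<in> S \<rightarrow>\<^sub>E S"
    and "M \<Zcomp>\<^bsub>S\<^esub> M = op_one S"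
    and "I \<Zcomp>\<^bsub>S\<^esub> I = M" and "J \<Zcomp>\<^bsub>S\<^esub> J = M" and "K \<Zcomp>\<^bsub>S\<^esub> K = M"
    and "I \<Zcomp>\<^bsub>S\<^esub> J = K"
    and "M \<Zcomp>\<^bsub>S\<^esub> I = I \<Zcomp>\<^bsub>S\<^esub> M" and "M \<Zcomp>\<^bsub>S\<^esub> J = J \<Zcomp>\<^bsub>S\<^esub> M" and "M \<Zcomp>\<^bsub>S\<^esub> K = K \<Zcomp>\<^bsub>S\<^esub> M"
  shows "(I \<Zcomp>\<^bsub>S\<^esub> I = J \<Zcomp>\<^bsub>S\<^esub> J \<and> J \<Zcomp>\<^bsub>S\<^esub> J = K \<Zcomp>\<^bsub>S\<^esub> K \<and>
          K \<Zcomp>\<^bsub>S\<^esub> K = I \<Zcomp>\<^bsub>S\<^esub> J \<Zcomp>\<^bsub>S\<^esub> K \<and> I \<Zcomp>\<^bsub>S\<^esub> J \<Zcomp>\<^bsub>S\<^esub> K = M) \<and>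
         (I \<Zcomp>\<^bsub>S\<^esub> J = K \<and> J \<Zcomp>\<^bsub>S\<^esub> K = I \<and> K \<Zcomp>\<^bsub>S\<^esub> I = J) \<and>
         (J \<Zcomp>\<^bsub>S\<^esub> I = K \<Zcomp>\<^bsub>S\<^esub> M \<and> K \<Zcomp>\<^bsub>S\<^esub> J = I \<Zcomp>\<^bsub>S\<^esub> M \<and> I \<Zcomp>\<^bsub>S\<^esub> K = J \<Zcomp>\<^bsub>S\<^esub> M)"
proof -
  note maps = assms(1-4) and invol = assms(5) and squares = assms(6-8)
    and IJ = assms(9) and comm = assms(10-12)
  \<comment> \<open>Opening \<open>K\<close> as IJ makes two copies of \<open>I\<close> meet, to be
    replaced by \<open>M\<close>; \<open>comm\<close> then pushes \<open>M\<close> to the right, the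
    form used in the conclusion.\<close>
  have "I \<Zcomp>\<^bsub>S\<^esub> K = I \<Zcomp>\<^bsub>S\<^esub> I \<Zcomp>\<^bsub>S\<^esub> J"
    using maps(2) by (simp add: op_seq_assoc IJ)
  then have IK: "I \<Zcomp>\<^bsub>S\<^esub> K = J \<Zcomp>\<^bsub>S\<^esub> M"
    by (simp add: squares comm)
  have "K \<Zcomp>\<^bsub>S\<^esub> J = I \<Zcomp>\<^bsub>S\<^esub> (J \<Zcomp>\<^bsub>S\<^esub> J)"
    using maps(2) by (simp add: IJ flip: op_seq_assoc)
  then have KJ: "K \<Zcomp>\<^bsub>S\<^esub> J = I \<Zcomp>\<^bsub>S\<^esub> M"
    by (simp add: squares)
  \<comment> \<open>Writing \<open>M\<close> as II puts an \<open>I\<close> directly before JK, and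
    the resulting IJK collapses to KK = M.\<close>
  have "M \<Zcomp>\<^bsub>S\<^esub> (J \<Zcomp>\<^bsub>S\<^esub> K) = I \<Zcomp>\<^bsub>S\<^esub> (I \<Zcomp>\<^bsub>S\<^esub> J \<Zcomp>\<^bsub>S\<^esub> K)"
    using maps(2) by (simp add: op_seq_assoc flip: squares(1))
  also have "\<dots> = M \<Zcomp>\<^bsub>S\<^esub> I"
    by (simp add: IJ squares comm)
  finally have JK: "J \<Zcomp>\<^bsub>S\<^esub> K = I"
    by (rule op_seq_involution_left_cancel[OF maps(1) op_seq_in_PiE[OF maps(3,4)] maps(2) invol])
  \<comment> \<open>Here \<open>M\<close> is expanded as JJ instead: its first \<open>J\<close>
    joins the preceding \<open>I\<close> to form \<open>K\<close>, leaving KKJ = MJ.\<close>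
  have "K \<Zcomp>\<^bsub>S\<^esub> I \<Zcomp>\<^bsub>S\<^esub> M = K \<Zcomp>\<^bsub>S\<^esub> (I \<Zcomp>\<^bsub>S\<^esub> J) \<Zcomp>\<^bsub>S\<^esub> J"
    using maps(2,4) by (simp add: op_seq_assoc op_seq_in_PiE flip: squares(2))
  also have "\<dots> = J \<Zcomp>\<^bsub>S\<^esub> M"
    by (simp add: IJ squares comm)
  finally have KI: "K \<Zcomp>\<^bsub>S\<^esub> I = J"
    by (rule op_seq_involution_right_cancel[OF maps(1) op_seq_in_PiE[OF maps(4,2)] maps(3) invol])
  have "J \<Zcomp>\<^bsub>S\<^esub> I = J \<Zcomp>\<^bsub>S\<^esub> J \<Zcomp>\<^bsub>S\<^esub> K"
    using maps(3) by (simp add: op_seq_assoc JK)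
  then have JI: "J \<Zcomp>\<^bsub>S\<^esub> I = K \<Zcomp>\<^bsub>S\<^esub> M"
    by (simp add: squares comm)
  show ?thesis
    \<comment> \<open>The one relation without a fact of its own, IJK = M, becomes KK = M after
      rewriting with \<open>IJ\<close>.\<close>
    using IK KJ JK KI JI squares IJ by simp
qed

end
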